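(* Let $\Gamma$ be a finite abelian group and let $S\subseteq\Gamma$ be skew-symmetric with $0\notin S$. Then the oriented Cayley graph $\mathrm{Cay}(\Gamma,S)$ is HS-integral if and only if $S\in\mathbb{E}(\Gamma)$.
   Context: $\Gamma$ is written additively; $x^k$ denotes $kx$ and $-x$ is the inverse of $x$. A set $S$ is skew-symmetric if $-a\notin S$ for all $a\in S$. $\mathrm{Cay}(\Gamma,S)$ has vertex set $\Gamma$ and arcs $(a,b)$ with $b-a\in S$. Its Hermitian adjacency matrix of second kind $\mathcal{H}=(h_{uv})$ has $h_{uv}=1$ if both $(u,v)$ and $(v,u)$ are arcs, $h_{uv}=\frac{1+i\sqrt3}{2}$ if only $(u,v)$ is an arc, $h_{uv}=\frac{1-i\sqrt3}{2}$ if only $(v,u)$ is an arc, and $h_{uv}=0$ otherwise. The graph is HS-integral if all eigenvalues of $\mathcal{H}$ are integers. $\Gamma(3)$ is the set of elements of $\Gamma$ whose order is divisible by $3$. For $x\in\Gamma(3)$ with $\mathrm{ord}(x)=m$, put $\langle\!\langle x\rangle\!\rangle=\{x^k:1\le k\le m-1,\ \gcd(k,m)=1,\ k\equiv 1\pmod 3\}$. If $\Gamma(3)\ne\emptyset$, $\mathbb{E}(\Gamma)$ is the set of skew-symmetric subsets of $\Gamma$ of the form $\langle\!\langle x_1\rangle\!\rangle\cup\cdots\cup\langle\!\langle x_k\rangle\!\rangle$ with $x_i\in\Gamma(3)$. If $\Gamma(3)=\emptyset$, then $\mathbb{E}(\Gamma)=\{\emptyset\}$. *)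

theory Defs
  imports
    Complex_Main
    "HOL-Algebra.Multiplicative_Group"
    "HOL-Number_Theory.Cong"
    "Graph_Theory.Pair_Digraph"
begin

text \<open>Groups are taken in the multiplicative notation of HOL-Algebra: the additive
  \<open>b - a\<close>, \<open>-a\<close>, \<open>0\<close> and \<open>k x\<close> become \<open>b \<otimes> inv a\<close>, \<open>inv a\<close>, \<open>\<one>\<close> and \<open>x [^] k\<close>.\<close>

definition skew_symmetric :: "('a, 'b) monoid_scheme \<Rightarrow> 'a set \<Rightarrow> bool" where
  "skew_symmetric G S \<longleftrightarrow> (\<forall>a\<in>S. inv\<^bsub>G\<^esub> a \<notin> S)"

definition Cay :: "('a, 'b) monoid_scheme \<Rightarrow> 'a set \<Rightarrow> 'a pair_pre_digraph" where
  "Cay G S = \<lparr> pverts = carrier G,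
     parcs = {(a, b). a \<in> carrier G \<and> b \<in> carrier G \<and> b \<otimes>\<^bsub>G\<^esub> inv\<^bsub>G\<^esub> a \<in> S} \<rparr>"

text \<open>Matrices of a graph are indexed by its vertices, so they are functions of two vertices,
  of which only the values on the vertex set matter.\<close>

definition hermitian_adjacency2 :: "'a pair_pre_digraph \<Rightarrow> 'a \<Rightarrow> 'a \<Rightarrow> complex" where
  "hermitian_adjacency2 D u v =
     (if (u, v) \<in> parcs D \<and> (v, u) \<in> parcs D then 1
      else if (u, v) \<in> parcs D then (1 + \<i> * sqrt 3) / 2
      else if (v, u) \<in> parcs D then (1 - \<i> * sqrt 3) / 2
      else 0)"

definition eigenvector_on :: "'a set \<Rightarrow> ('a \<Rightarrow> 'a \<Rightarrow> complex) \<Rightarrow> ('a \<Rightarrow> complex) \<Rightarrow> complex \<Rightarrow> bool" where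
  "eigenvector_on V M f k \<longleftrightarrow>
     (\<exists>u\<in>V. f u \<noteq> 0) \<and> (\<forall>u\<in>V. (\<Sum>v\<in>V. M u v * f v) = k * f u)"

definition eigenvalue_on :: "'a set \<Rightarrow> ('a \<Rightarrow> 'a \<Rightarrow> complex) \<Rightarrow> complex \<Rightarrow> bool" where
  "eigenvalue_on V M k \<longleftrightarrow> (\<exists>f. eigenvector_on V M f k)"

definition HS_integral :: "'a pair_pre_digraph \<Rightarrow> bool" where
  "HS_integral D \<longleftrightarrow> (\<forall>k. eigenvalue_on (pverts D) (hermitian_adjacency2 D) k \<longrightarrow> k \<in> \<int>)"

definition order_div3 :: "('a, 'b) monoid_scheme \<Rightarrow> 'a set" where
  "order_div3 G = {x \<in> carrier G. 3 dvd group.ord G x}"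

definition dbl_angle :: "('a, 'b) monoid_scheme \<Rightarrow> 'a \<Rightarrow> 'a set" where
  "dbl_angle G x = {x [^]\<^bsub>G\<^esub> k | k :: nat.
     1 \<le> k \<and> k \<le> group.ord G x - 1 \<and> coprime k (group.ord G x) \<and> [k = 1] (mod 3)}"

text \<open>The empty union is allowed, so the empty set always belongs to \<open>EE G\<close>.\<close>

definition EE :: "('a, 'b) monoid_scheme \<Rightarrow> 'a set set" where
  "EE G = (if order_div3 G \<noteq> {}
     then {S. S \<subseteq> carrier G \<and> skew_symmetric G S \<and>
              (\<exists>X. finite X \<and> X \<subseteq> order_div3 G \<and> S = (\<Union>x\<in>X. dbl_angle G x))}
     else {{}})"

end

theory Submission
  imports
    Defs
    "Jordan_Normal_Form.Char_Poly"
    "HOL-Number_Theory.Residues"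
begin

text \<open>
  Write \<open>\<omega>\<close> for a primitive cube root of unity and let \<open>w\<close> be \<open>\<omega>\<^sup>2\<close> on \<open>S\<close>, \<open>\<omega>\<close> on \<open>-S\<close> and \<open>0\<close>
  elsewhere. The eigenvalues of the Hermitian adjacency matrix are the numbers
  \<open>- (\<Sum>x. w x * \<psi> x)\<close> for the characters \<open>\<psi>\<close> of the group, and they lie in \<open>\<int>[\<zeta>]\<close>, where \<open>\<zeta>\<close>
  has order \<open>3n\<close> and \<open>n\<close> is the order of the group. Integrality of all of them is equivalent to
  \<open>w (k x) = (w x)\<^sup>k\<close> for all \<open>x\<close> and all \<open>k\<close> coprime to \<open>3n\<close>, which is the combinatorial
  condition on \<open>S\<close> in disguise.

  No Galois theory is needed for this equivalence. If all eigenvalues are integers and \<open>p\<close> is a prime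
  not dividing \<open>3n\<close>, then raising an eigenvalue to the \<open>p\<close>-th power changes nothing modulo \<open>p\<close>
  by Fermat's theorem, while the Frobenius map turns it into
  \<open>\<Sum>x. (w x)\<^sup>p * \<psi> (p x)\<close>. Fourier inversion shows that \<open>p\<close> divides
  \<open>n * (w (p x) - (w x)\<^sup>p)\<close> in \<open>\<int>[\<zeta>]\<close>; the second factor is a difference of elements of
  \<open>{0, \<omega>, \<omega>\<^sup>2}\<close>, so it divides 3 unless it vanishes, and vanish it must. Every \<open>k\<close> coprime to
  \<open>3n\<close> is a product of such primes. Conversely, averaging the \<open>k\<close>-th conjugates of an
  eigenvalue over all \<open>k\<close> coprime to \<open>3n\<close> expresses it through Ramanujan sums, which are
  integers; so it is a rational element of \<open>\<int>[\<zeta>]\<close>, hence an integer.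
\<close>

hide_const (open) Polynomial.order

section \<open>Integers of cyclotomic fields\<close>

text \<open>The ring Z[zeta] for zeta of order \<open>N\<close>, as the integer span of all
  \<open>N\<close> powers of zeta. These powers are linearly dependent for \<open>N > 1\<close>, so
  coefficients are not unique, but products only require reducing exponents modulo
  \<open>N\<close>.\<close>

definition cyclotomic_ring :: "nat \<Rightarrow> complex set" where
  "cyclotomic_ring N = range (\<lambda>c :: nat \<Rightarrow> int. \<Sum>j<N. of_int (c j) * cis (2 * pi / N) ^ j)"

lemma cis_root_pow_mod:
  assumes "N > 0"
  shows "cis (2 * pi / real N) ^ j = cis (2 * pi / real N) ^ (j mod N)"
proof -
  have 1: "cis (2 * pi / real N) ^ N = 1"
    using assms by (simp add: DeMoivre)
  have "cis (2 * pi / real N) ^ j = cis (2 * pi / real N) ^ (N * (j div N) + j mod N)"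
    by simp
  also have "\<dots> = cis (2 * pi / real N) ^ (j mod N)"
    unfolding power_add power_mult 1 by simp
  finally show ?thesis .
qed

lemma cyclotomic_ring_add:
  assumes "x \<in> cyclotomic_ring N" "y \<in> cyclotomic_ring N"
  shows "x + y \<in> cyclotomic_ring N"
proof -
  obtain c d :: "nat \<Rightarrow> int"
    where "x = (\<Sum>j<N. of_int (c j) * cis (2 * pi / N) ^ j)"
      and "y = (\<Sum>j<N. of_int (d j) * cis (2 * pi / N) ^ j)"
    using assms by (auto simp: cyclotomic_ring_def)
  then have "x + y = (\<Sum>j<N. of_int (c j + d j) * cis (2 * pi / N) ^ j)"
    by (simp add: sum.distrib algebra_simps)
  then show ?thesis
    unfolding cyclotomic_ring_def by (rule image_eqI[where x = "\<lambda>j. c j + d j"]) simp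
qed

lemma cyclotomic_ring_scale:
  assumes "x \<in> cyclotomic_ring N"
  shows "of_int a * x \<in> cyclotomic_ring N"
proof -
  obtain c :: "nat \<Rightarrow> int" where "x = (\<Sum>j<N. of_int (c j) * cis (2 * pi / N) ^ j)"
    using assms by (auto simp: cyclotomic_ring_def)
  then have "of_int a * x = (\<Sum>j<N. of_int (a * c j) * cis (2 * pi / N) ^ j)"
    by (simp add: sum_distrib_left algebra_simps)
  then show ?thesis
    unfolding cyclotomic_ring_def by (rule image_eqI[where x = "\<lambda>j. a * c j"]) simp
qed

lemma cyclotomic_ring_0: "0 \<in> cyclotomic_ring N"
  unfolding cyclotomic_ring_def by (rule image_eqI[where x = "\<lambda>_. 0"]) auto

lemma cyclotomic_ring_sum:
  assumes "\<And>i. i \<in> I \<Longrightarrow> f i \<in> cyclotomic_ring N"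
  shows "sum f I \<in> cyclotomic_ring N"
  using assms
  by (induction I rule: infinite_finite_induct)
    (auto intro: cyclotomic_ring_add cyclotomic_ring_0)

lemma cyclotomic_ring_root_power:
  assumes "N > 0"
  shows "cis (2 * pi / real N) ^ j \<in> cyclotomic_ring N"
proof -
  have "cis (2 * pi / real N) ^ j
      = (\<Sum>i<N. of_int (if i = j mod N then 1 else 0) * cis (2 * pi / N) ^ i)"
    using assms cis_root_pow_mod[of N j]
    by (subst sum.remove[of _ "j mod N"]) (auto intro!: sum.neutral)
  then show ?thesis
    unfolding cyclotomic_ring_def
    by (rule image_eqI[where x = "\<lambda>i. if i = j mod N then 1 else 0"]) simp
qed

lemma cyclotomic_ring_mult:
  assumes N: "N > 0" and "x \<in> cyclotomic_ring N" "y \<in> cyclotomic_ring N"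
  shows "x * y \<in> cyclotomic_ring N"
proof -
  obtain c d :: "nat \<Rightarrow> int"
    where x: "x = (\<Sum>j<N. of_int (c j) * cis (2 * pi / N) ^ j)"
      and y: "y = (\<Sum>j<N. of_int (d j) * cis (2 * pi / N) ^ j)"
    using assms by (auto simp: cyclotomic_ring_def)
  have "x * y = (\<Sum>i<N. \<Sum>j<N. of_int (c i * d j) * cis (2 * pi / N) ^ (i + j))"
    unfolding x y sum_product by (intro sum.cong refl) (simp add: power_add del: cis_mult)
  also have "\<dots> \<in> cyclotomic_ring N"
    by (intro cyclotomic_ring_sum cyclotomic_ring_scale cyclotomic_ring_root_power N)
  finally show ?thesis .
qed

lemma cyclotomic_ring_1: "N > 0 \<Longrightarrow> 1 \<in> cyclotomic_ring N"
  using cyclotomic_ring_root_power[of N 0] by simp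

lemma cyclotomic_ring_power:
  "N > 0 \<Longrightarrow> x \<in> cyclotomic_ring N \<Longrightarrow> x ^ k \<in> cyclotomic_ring N"
  by (induction k) (auto intro: cyclotomic_ring_mult cyclotomic_ring_1)

lemma cyclotomic_ring_of_int: "N > 0 \<Longrightarrow> of_int a \<in> cyclotomic_ring N"
  using cyclotomic_ring_scale[OF cyclotomic_ring_1, of N a] by simp

lemma cyclotomic_ring_diff:
  "x \<in> cyclotomic_ring N \<Longrightarrow> y \<in> cyclotomic_ring N \<Longrightarrow> x - y \<in> cyclotomic_ring N"
  using cyclotomic_ring_add[of x N "of_int (- 1) * y"] cyclotomic_ring_scale[of y N "- 1"] by simp

lemma root_unity_in_cyclotomic_ring:
  assumes "N > 0" "z ^ N = 1"
  shows "z \<in> cyclotomic_ring N"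
proof -
  obtain k where "z = cis (2 * pi * real k / real N)"
    using bij_betw_roots_unity[OF assms(1)] assms(2) by (auto simp: bij_betw_def)
  then have "z = cis (2 * pi / real N) ^ k"
    by (simp add: DeMoivre mult_ac)
  with cyclotomic_ring_root_power[OF assms(1)] show ?thesis by simp
qed

text \<open>Multiplication by \<open>x\<close> acts on the powers of the root of unity by an integer matrix.\<close>

lemma algebraic_int_cyclotomic_ring:
  assumes N: "N > 0" and x: "x \<in> cyclotomic_ring N"
  shows "algebraic_int x"
proof -
  let ?z = "cis (2 * pi / real N)"
  have "\<exists>c :: nat \<Rightarrow> int. x * ?z ^ i = (\<Sum>j<N. of_int (c j) * ?z ^ j)" for i
    using cyclotomic_ring_mult[OF N x cyclotomic_ring_root_power[OF N, of i]]
    by (auto simp: cyclotomic_ring_def)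
  then obtain c :: "nat \<Rightarrow> nat \<Rightarrow> int"
    where c: "\<And>i. x * ?z ^ i = (\<Sum>j<N. of_int (c i j) * ?z ^ j)"
    by metis
  define M :: "int mat" where "M = mat N N (\<lambda>(i, j). c i j)"
  define v where "v = vec N (\<lambda>j. ?z ^ j)"
  have M: "M \<in> carrier_mat N N"
    by (simp add: M_def)
  have "map_mat of_int M *\<^sub>v v = x \<cdot>\<^sub>v v"
    by (rule eq_vecI)
      (auto simp: M_def v_def scalar_prod_def c lessThan_atLeast0 intro!: sum.cong)
  moreover have "v \<noteq> 0\<^sub>v N"
  proof
    assume "v = 0\<^sub>v N"
    then have "v $ 0 = 0" using N by simp
    then show False using N by (simp add: v_def)
  qed
  \<comment> \<open>Hence \<open>x\<close> is a root of the characteristic polynomial of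
    \<open>M\<close>, which is monic with integer coefficients.\<close>
  ultimately have "eigenvalue (map_mat of_int M) x"
    by (auto simp: eigenvalue_def eigenvector_def M_def v_def intro!: exI[of _ v])
  then have "poly (char_poly (map_mat of_int M)) x = 0"
    using eigenvalue_root_char_poly[of "map_mat of_int M" N x] M by simp
  moreover have "lead_coeff (char_poly M) = 1"
    using degree_monic_char_poly[OF M] by simp
  ultimately show ?thesis
    unfolding algebraic_int_altdef_ipoly
    by (auto simp: of_int_hom.char_poly_hom[OF M])
qed

lemma cyclotomic_ring_rational_imp_int:
  "N > 0 \<Longrightarrow> x \<in> cyclotomic_ring N \<Longrightarrow> x \<in> \<rat> \<Longrightarrow> x \<in> \<int>"
  using algebraic_int_cyclotomic_ring rational_algebraic_int_is_int by blast

section \<open>The Frobenius map and Fermat's theorem modulo a prime\<close>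

text \<open>All inner binomial coefficients are divisible by \<open>p\<close>; \<open>r\<close>
  collects the exact quotients.\<close>

lemma cyclotomic_ring_frobenius_add:
  assumes N: "N > 0" and p: "prime p" and x: "x \<in> cyclotomic_ring N" and y: "y \<in> cyclotomic_ring N"
  obtains r where "r \<in> cyclotomic_ring N" "(x + y) ^ p = x ^ p + y ^ p + of_nat p * r"
proof -
  define r where "r = (\<Sum>k\<in>{0<..<p}. of_int (int ((p choose k) div p)) * (x ^ k * y ^ (p - k)))"
  have p1: "p > 1" using p prime_gt_1_nat by blast
  have set: "{..p} = insert 0 (insert p {0<..<p})" by auto
  have "(x + y) ^ p = x ^ p + y ^ p + (\<Sum>k\<in>{0<..<p}. of_nat (p choose k) * x ^ k * y ^ (p - k))"
    unfolding binomial_ring set using p1 by simp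
  also have "(\<Sum>k\<in>{0<..<p}. of_nat (p choose k) * x ^ k * y ^ (p - k)) = of_nat p * r"
    unfolding r_def sum_distrib_left
  proof (intro sum.cong refl)
    fix k assume k: "k \<in> {0<..<p}"
    then have "p dvd p choose k"
      using p by (intro dvd_choose_prime) auto
    then have "p choose k = p * ((p choose k) div p)" by simp
    then have "(of_nat (p choose k) :: complex) = of_nat p * of_nat ((p choose k) div p)"
      by (metis of_nat_mult)
    then show "of_nat (p choose k) * x ^ k * y ^ (p - k)
        = of_nat p * (of_int (int ((p choose k) div p)) * (x ^ k * y ^ (p - k)))" by simp
  qed
  finally have "(x + y) ^ p = x ^ p + y ^ p + of_nat p * r" .
  moreover have "r \<in> cyclotomic_ring N"
    unfolding r_def
    by (intro cyclotomic_ring_sum cyclotomic_ring_scale cyclotomic_ring_mult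
        cyclotomic_ring_power N x y)
  ultimately show ?thesis using that by blast
qed

lemma cyclotomic_ring_frobenius_sum:
  assumes N: "N > 0" and p: "prime p" and fin: "finite I"
    and f: "\<And>i. i \<in> I \<Longrightarrow> f i \<in> cyclotomic_ring N"
  shows "\<exists>r\<in>cyclotomic_ring N. (\<Sum>i\<in>I. f i) ^ p = (\<Sum>i\<in>I. f i ^ p) + of_nat p * r"
  using fin f
proof (induction I)
  case empty
  \<comment> \<open>This makes \<open>0 ^ p = 0\<close>, so the empty sum works with
    \<open>r = 0\<close>.\<close>
  have "p > 0" using p prime_gt_0_nat by blast
  then show ?case using cyclotomic_ring_0 by force
next
  case (insert i I)
  then obtain r where r: "r \<in> cyclotomic_ring N"
    "(\<Sum>i\<in>I. f i) ^ p = (\<Sum>i\<in>I. f i ^ p) + of_nat p * r" by auto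
  obtain s where s: "s \<in> cyclotomic_ring N"
    "(f i + (\<Sum>i\<in>I. f i)) ^ p = f i ^ p + (\<Sum>i\<in>I. f i) ^ p + of_nat p * s"
    using cyclotomic_ring_frobenius_add[OF N p, of "f i" "\<Sum>i\<in>I. f i"] insert.prems
      cyclotomic_ring_sum[of I f N] by auto
  have "(\<Sum>j\<in>insert i I. f j) ^ p = (\<Sum>j\<in>insert i I. f j ^ p) + of_nat p * (r + s)"
    using insert.hyps r(2) s(2) by (simp add: algebra_simps)
  then show ?case using cyclotomic_ring_add r(1) s(1) by blast
qed

text \<open>Negative integers are replaced by their residue \<open>b\<close>, a natural number.
  Multiples of \<open>p\<close> satisfy the congruence trivially; all others are units modulo
  \<open>p\<close>.\<close>

lemma fermat_int:
  fixes a :: int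
  assumes "prime p"
  shows "int p dvd a ^ p - a"
proof -
  have p: "p > 1" using assms prime_gt_1_nat by blast
  define b where "b = nat (a mod int p)"
  have b: "[a = int b] (mod int p)"
    using p by (simp add: b_def cong_def)
  have "[b ^ p = b] (mod p)"
  proof (cases "p dvd b")
    case True
    moreover have "p dvd b ^ p" using True p by (auto intro: dvd_trans[OF _ dvd_power])
    ultimately show ?thesis by (simp add: cong_def)
  next
    case False
    then have "[b * b ^ (p - 1) = b * 1] (mod p)"
      using fermat_theorem[OF assms] cong_scalar_left by blast
    then show ?thesis using p by (simp add: power_eq_if)
  qed
  then have "[int b ^ p = int b] (mod int p)"
    by (metis cong_int_iff of_nat_power)
  then have "[a ^ p = a] (mod int p)"
    using b by (meson cong_pow cong_sym cong_trans)
  then show ?thesis by (simp add: cong_iff_dvd_diff)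
qed

section \<open>Ramanujan sums, lifting of units, sums over roots of unity\<close>

text \<open>Group the exponents from 1 to \<open>N\<close> by their gcd \<open>d\<close> with
  \<open>N\<close>: each group is a Ramanujan sum of \<open>z ^ d\<close> for the modulus
  \<open>N div d\<close>. The full sum is \<open>N\<close> or 0 by the geometric series, the group
  \<open>d = 1\<close> is the sum in question, and the other groups have smaller modulus. The root
  \<open>z\<close> may be imprimitive, which the induction requires.\<close>

lemma ramanujan_sum_int:
  fixes z :: complex
  assumes "N > 0" "z ^ N = 1"
  shows "(\<Sum>k | k \<in> {1..N} \<and> coprime k N. z ^ k) \<in> \<int>"
  using assms
proof (induction N arbitrary: z rule: less_induct)
  case (less N)
  let ?C = "\<lambda>N. {k. k \<in> {1..N} \<and> coprime k N}"
  let ?D = "{d. d dvd N}"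
  have fin: "finite ?D" using less.prems by simp
  have "(\<Sum>k=1..N. z ^ k) = (\<Sum>d\<in>?D. \<Sum>k | k \<in> {1..N} \<and> gcd k N = d. z ^ k)"
    by (rule sum.group[symmetric, where g = "\<lambda>k. gcd k N", simplified]) (use fin in auto)
  also have "\<dots> = (\<Sum>d\<in>?D. \<Sum>k\<in>?C (N div d). (z ^ d) ^ k)"
  proof (rule sum.cong[OF refl])
    fix d assume "d \<in> ?D"
    then obtain e where N: "N = d * e" by auto
    have d: "d > 0" "e > 0" using less.prems N by auto
    have "(\<Sum>k\<in>?C e. (z ^ d) ^ k) = (\<Sum>k | k \<in> {1..N} \<and> gcd k N = d. z ^ k)"
    proof (rule sum.reindex_bij_witness[of _ "\<lambda>k. k div d" "\<lambda>k. d * k"])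
      fix k assume "k \<in> {k. k \<in> {1..N} \<and> gcd k N = d}"
      then have k: "1 \<le> k" "k \<le> N" "gcd k N = d" by auto
      then obtain l where l: "k = d * l" by (metis dvdE gcd_dvd1)
      have "gcd k N = d * gcd l e" by (simp add: l N gcd_mult_distrib_nat)
      then have "gcd l e = 1" using k d by simp
      then have "coprime l e" using coprime_iff_gcd_eq_1 by blast
      then show "k div d \<in> ?C e" using k d by (auto simp: l N)
      show "d * (k div d) = k" using l d by simp
    qed (use d in \<open>auto simp: N power_mult gcd_mult_distrib_nat[symmetric]\<close>)
    then show "(\<Sum>k | k \<in> {1..N} \<and> gcd k N = d. z ^ k) = (\<Sum>k\<in>?C (N div d). (z ^ d) ^ k)"
      using d by (simp add: N)
  qed
  also have "\<dots> = (\<Sum>k\<in>?C N. z ^ k) + (\<Sum>d\<in>?D - {1}. \<Sum>k\<in>?C (N div d). (z ^ d) ^ k)"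
    by (subst sum.remove[of _ 1]) (use fin in auto)
  finally have eq: "(\<Sum>k\<in>?C N. z ^ k)
      = (\<Sum>k=1..N. z ^ k) - (\<Sum>d\<in>?D - {1}. \<Sum>k\<in>?C (N div d). (z ^ d) ^ k)"
    by simp
  have "(\<Sum>k=1..N. z ^ k) \<in> \<int>"
  proof (cases "z = 1")
    case False
    have "(\<Sum>k=1..N. z ^ k) = z * (\<Sum>k<N. z ^ k)"
      by (simp add: sum_distrib_left sum.atLeast1_atMost_eq)
    also have "(\<Sum>k<N. z ^ k) = 0"
      using geometric_sum[OF False, of N] less.prems by simp
    finally show ?thesis by simp
  qed simp
  moreover have "(\<Sum>d\<in>?D - {1}. \<Sum>k\<in>?C (N div d). (z ^ d) ^ k) \<in> \<int>"
  proof (rule Ints_sum)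
    fix d assume d: "d \<in> ?D - {1}"
    then have "d > 1" using less.prems by (cases d) auto
    then show "(\<Sum>k\<in>?C (N div d). (z ^ d) ^ k) \<in> \<int>"
      using d less.prems
      by (intro less.IH) (auto simp: div_greater_zero_iff dvd_imp_le simp flip: power_mult)
  qed
  ultimately show ?case unfolding eq by (rule Ints_diff)
qed

text \<open>Adding \<open>m * t\<close> to \<open>k\<close> works when \<open>t\<close> is the
  product of the primes of \<open>N\<close> that do not divide \<open>k\<close>: every prime of
  \<open>N\<close> then divides exactly one of \<open>k\<close> and \<open>m * t\<close>, or divides
  \<open>t\<close> but not \<open>k\<close>, and so never divides the sum.\<close>

lemma coprime_lift:
  fixes k m N :: nat
  assumes "coprime k m" "N > 0"
  obtains k' where "[k' = k] (mod m)" "coprime k' N" "k' > 0"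
proof -
  define t where "t = (\<Prod>q\<in>{q \<in> prime_factors N. \<not> q dvd k}. q)"
  define k' where "k' = k + m * t"
  have t: "q dvd t \<longleftrightarrow> \<not> q dvd k" if "prime q" "q dvd N" for q
    using that assms(2) unfolding t_def
    by (subst prime_dvd_prod_iff)
       (auto simp: in_prime_factors_iff dest: primes_dvd_imp_eq intro: bexI[of _ q])
  have cop: "coprime k' N"
  proof (rule ccontr)
    assume "\<not> coprime k' N"
    then obtain q where q: "prime q" "q dvd k'" "q dvd N"
      by (metis coprime_iff_gcd_eq_1 gcd_dvd1 gcd_dvd2 dvd_trans prime_factor_nat)
    show False
    proof (cases "q dvd k")
      case True
      then have "q dvd m * t" using q by (simp add: k'_def dvd_add_right_iff)
      moreover have "\<not> q dvd m" using True assms(1) q(1) coprime_common_divisor not_prime_unit by blast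
      ultimately show False using t[OF q(1,3)] True q(1) prime_dvd_mult_iff by blast
    next
      case False
      then show False using t[OF q(1,3)] q(2) by (simp add: k'_def dvd_add_left_iff)
    qed
  qed
  show ?thesis
  proof (cases "k' = 0")
    case False
    then show ?thesis using that[of k'] cop by (simp add: k'_def cong_def)
  next
    case True
    \<comment> \<open>Here \<open>k = 0\<close>, and coprimality forces \<open>m = N = 1\<close>, so
      \<open>m\<close> itself serves as the positive representative.\<close>
    then show ?thesis using that[of m] cop assms by (auto simp: k'_def cong_def)
  qed
qed

lemma coprime_3_mod:
  fixes k :: nat
  assumes "coprime k 3"
  shows "k mod 3 = 1 \<or> k mod 3 = 2"
proof -
  have "\<not> 3 dvd k"
    using coprime_common_divisor_nat[of k 3 3] assms by auto
  then show ?thesis by presburger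
qed

text \<open>Multiplication by a primitive root \<open>z\<close> permutes the roots of unity and
  scales the sum by \<open>z ^ j\<close>, which differs from 1.\<close>

lemma sum_roots_unity_power:
  assumes "0 < j" "j < n"
  shows "(\<Sum>c | c ^ n = 1. c ^ j) = (0 :: complex)"
proof -
  define z where "z = cis (2 * pi / real n)"
  have n: "n > 0" using assms by simp
  have zn: "z ^ n = 1" using n by (simp add: z_def DeMoivre)
  have "z ^ j \<noteq> 1"
  proof
    assume "z ^ j = 1"
    then have eq: "cis (2 * pi * real j / real n) = cis (2 * pi * real 0 / real n)"
      by (simp add: z_def DeMoivre mult_ac)
    have inj: "inj_on (\<lambda>k. cis (2 * pi * real k / real n)) {..<n}"
      using bij_betw_roots_unity[OF n] by (simp add: bij_betw_def)
    show False using inj_onD[OF inj eq] assms by simp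
  qed
  have z0: "z \<noteq> 0" by (simp add: z_def)
  have "(\<Sum>c | c ^ n = 1. c ^ j) = (\<Sum>c | c ^ n = 1. (z * c) ^ j)"
    by (rule sum.reindex_bij_witness[of _ "\<lambda>c. z * c" "\<lambda>c. c / z"])
      (use z0 zn in \<open>auto simp: power_mult_distrib power_divide\<close>)
  also have "\<dots> = z ^ j * (\<Sum>c | c ^ n = 1. c ^ j)"
    by (simp add: power_mult_distrib sum_distrib_left)
  finally show ?thesis using \<open>z ^ j \<noteq> 1\<close> by simp
qed

section \<open>Characters of finite abelian groups\<close>

lemma (in group) pow_cong_ord:
  assumes "x \<in> carrier G" "[k = l] (mod ord x)"
  shows "x [^] (k :: nat) = x [^] l"
proof -
  have *: "x [^] (ord x * q + r) = x [^] r" for q r :: nat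
    using assms(1) by (simp flip: nat_pow_mult nat_pow_pow)
  show ?thesis
    using *[of "k div ord x" "k mod ord x"] *[of "l div ord x" "l mod ord x"] assms(2)
    by (simp add: cong_def)
qed

locale finite_abelian_group = comm_group +
  assumes finite_carrier [simp, intro]: "finite (carrier G)"
begin

lemma order_pos: "order G > 0"
  using finite_carrier by (simp add: order_gt_0_iff_finite)

text \<open>Homomorphisms into the nonzero complex numbers take values in these roots of unity
  anyway; naming the finite codomain gives finiteness at once. Extensionality fixes the values off
  the carrier, so that characters can be counted.\<close>

definition characters :: "('a \<Rightarrow> complex) set" where
  "characters = {\<psi> \<in> carrier G \<rightarrow>\<^sub>E {z. z ^ order G = 1}.
     \<forall>x\<in>carrier G. \<forall>y\<in>carrier G. \<psi> (x \<otimes> y) = \<psi> x * \<psi> y}"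

lemma finite_characters [simp, intro]: "finite characters"
proof -
  have "finite (carrier G \<rightarrow>\<^sub>E {z :: complex. z ^ order G = 1})"
    using order_pos by (intro finite_PiE) (auto intro: finite_roots_unity)
  then show ?thesis
    by (rule rev_finite_subset) (auto simp: characters_def)
qed

lemma character_mult:
  "\<psi> \<in> characters \<Longrightarrow> x \<in> carrier G \<Longrightarrow> y \<in> carrier G \<Longrightarrow> \<psi> (x \<otimes> y) = \<psi> x * \<psi> y"
  by (simp add: characters_def)

lemma character_root_unity:
  "\<psi> \<in> characters \<Longrightarrow> x \<in> carrier G \<Longrightarrow> \<psi> x ^ order G = 1"
  by (auto simp: characters_def PiE_def Pi_def)

lemma character_nonzero: "\<psi> \<in> characters \<Longrightarrow> x \<in> carrier G \<Longrightarrow> \<psi> x \<noteq> 0"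
  using character_root_unity[of \<psi> x] order_pos by (auto simp: power_0_left)

lemma character_one: "\<psi> \<in> characters \<Longrightarrow> \<psi> \<one> = 1"
  using character_mult[of \<psi> \<one> \<one>] character_nonzero[of \<psi> \<one>] by simp

lemma character_pow:
  "\<psi> \<in> characters \<Longrightarrow> x \<in> carrier G \<Longrightarrow> \<psi> (x [^] (k :: nat)) = \<psi> x ^ k"
  by (induction k) (simp_all add: character_one character_mult)

text \<open>The sum below is a multiple of the projection of \<open>f\<close> to an eigenspace of the translation
  by \<open>g\<close>; the projections for all roots of unity \<open>c\<close> add up to \<open>f\<close>, so one of them is nonzero.\<close>

lemma translation_eigenvector:
  fixes W :: "('a \<Rightarrow> complex) \<Rightarrow> bool"
  assumes lin: "\<And>f h a b. W f \<Longrightarrow> W h \<Longrightarrow> W (\<lambda>x. a * f x + b * h x)"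
    and trans: "\<And>f g. W f \<Longrightarrow> g \<in> carrier G \<Longrightarrow> W (\<lambda>x. f (x \<otimes> g))"
    and f: "W f" and u: "u \<in> carrier G" "f u \<noteq> 0" and g: "g \<in> carrier G"
  obtains c where "W (\<lambda>x. \<Sum>j<order G. c ^ j * f (x \<otimes> g [^] j))"
    "(\<Sum>j<order G. c ^ j * f (u \<otimes> g [^] j)) \<noteq> 0"
    "\<And>x. x \<in> carrier G \<Longrightarrow> (\<Sum>j<order G. c ^ j * f (x \<otimes> g \<otimes> g [^] j))
        = inverse c * (\<Sum>j<order G. c ^ j * f (x \<otimes> g [^] j))"
proof -
  define n where "n = order G"
  have n: "n > 0" using order_pos by (simp add: n_def)
  define P where "P c x = (\<Sum>j<n. c ^ j * f (x \<otimes> g [^] j))" for c x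
  have fin: "finite {c :: complex. c ^ n = 1}"
    using n by (intro finite_roots_unity) auto
  have W_sum: "W (\<lambda>x. \<Sum>j<m. c ^ j * f (x \<otimes> g [^] j))" for c and m :: nat
  proof (induction m)
    case 0
    then show ?case using lin[OF f f, of 0 0] by simp
  next
    case (Suc m)
    then show ?case
      using lin[OF Suc trans[OF f, of "g [^] m"], of 1 "c ^ m"] g by simp
  qed
  have "(\<Sum>c | c ^ n = 1. P c u) = (\<Sum>j<n. (\<Sum>c | c ^ n = 1. c ^ j) * f (u \<otimes> g [^] j))"
    unfolding P_def by (subst sum.swap) (simp add: sum_distrib_right)
  also have "\<dots> = (\<Sum>j\<in>{0}. (\<Sum>c :: complex | c ^ n = 1. c ^ j) * f (u \<otimes> g [^] j))"
    using n by (intro sum.mono_neutral_right) (auto simp: sum_roots_unity_power)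
  also have "\<dots> = of_nat n * f u"
    using u g n by (simp add: card_roots_unity_eq)
  finally have "(\<Sum>c | c ^ n = 1. P c u) \<noteq> 0"
    using n u by simp
  then obtain c where c: "c ^ n = 1" "P c u \<noteq> 0"
    by (auto elim: sum.not_neutral_contains_not_neutral)
  have c0: "c \<noteq> 0" using c n by (auto simp: power_0_left)
  have "P c (x \<otimes> g) = inverse c * P c x" if x: "x \<in> carrier G" for x
  proof -
    \<comment> \<open>Shifting the index by one maps the sum to itself, since the terms at 0 and
      \<open>n\<close> agree: both \<open>c\<close> and \<open>g\<close> have trivial
      \<open>n\<close>-th power.\<close>
    have "c * P c (x \<otimes> g) = (\<Sum>j<n. c ^ Suc j * f (x \<otimes> g [^] Suc j))"
      unfolding P_def sum_distrib_left using x g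
      by (intro sum.cong refl) (simp add: m_assoc flip: nat_pow_Suc2 del: nat_pow_Suc)
    also have "\<dots> = (\<Sum>j<Suc n. c ^ j * f (x \<otimes> g [^] j)) - f x"
      using x g by (subst sum.lessThan_Suc_shift) simp
    also have "\<dots> = P c x"
      using x g c pow_order_eq_1[OF g] by (simp add: P_def n_def)
    finally show ?thesis using c0 by (simp add: field_simps)
  qed
  then show ?thesis
    using that[of c] c W_sum[of c n] by (simp add: P_def n_def)
qed

text \<open>Simultaneous diagonalisation of the commuting translations on the invariant space
  \<open>W\<close>. Group elements are treated one at a time; projecting to an eigenspace of a new
  translation preserves the eigenvector relations already obtained. A common eigenvector, scaled to
  be 1 at the identity, is a character.\<close>

lemma translation_invariant_contains_character:
  fixes W :: "('a \<Rightarrow> complex) \<Rightarrow> bool"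
  assumes lin: "\<And>f h a b. W f \<Longrightarrow> W h \<Longrightarrow> W (\<lambda>x. a * f x + b * h x)"
    and trans: "\<And>f g. W f \<Longrightarrow> g \<in> carrier G \<Longrightarrow> W (\<lambda>x. f (x \<otimes> g))"
    and cong: "\<And>f h. W f \<Longrightarrow> (\<And>x. x \<in> carrier G \<Longrightarrow> f x = h x) \<Longrightarrow> W h"
    and f: "W f" and u: "u \<in> carrier G" "f u \<noteq> 0"
  shows "\<exists>\<psi>\<in>characters. W \<psi>"
proof -
  have "\<exists>f. W f \<and> (\<exists>u\<in>carrier G. f u \<noteq> 0) \<and>
      (\<forall>g\<in>F. \<exists>c. \<forall>x\<in>carrier G. f (x \<otimes> g) = c * f x)"
    if "finite F" "F \<subseteq> carrier G" for F
    using that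
  proof (induction F)
    case empty
    then show ?case using f u by blast
  next
    case (insert g F)
    from insert.IH insert.prems obtain f u where f: "W f" "u \<in> carrier G" "f u \<noteq> 0"
      and F: "\<And>h. h \<in> F \<Longrightarrow> \<exists>c. \<forall>x\<in>carrier G. f (x \<otimes> h) = c * f x"
      by blast
    have g: "g \<in> carrier G" using insert.prems by simp
    obtain c where c: "W (\<lambda>x. \<Sum>j<order G. c ^ j * f (x \<otimes> g [^] j))"
      "(\<Sum>j<order G. c ^ j * f (u \<otimes> g [^] j)) \<noteq> 0"
      "\<And>x. x \<in> carrier G \<Longrightarrow> (\<Sum>j<order G. c ^ j * f (x \<otimes> g \<otimes> g [^] j))
        = inverse c * (\<Sum>j<order G. c ^ j * f (x \<otimes> g [^] j))"
      by (rule translation_eigenvector[of W f u g]) (use lin trans f g in auto)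
    have "\<exists>d. \<forall>x\<in>carrier G. (\<Sum>j<order G. c ^ j * f (x \<otimes> h \<otimes> g [^] j))
        = d * (\<Sum>j<order G. c ^ j * f (x \<otimes> g [^] j))" if h: "h \<in> F" for h
    proof -
      obtain d where d: "\<And>x. x \<in> carrier G \<Longrightarrow> f (x \<otimes> h) = d * f x"
        using F[OF h] by blast
      have hG: "h \<in> carrier G" using h insert.prems by blast
      have "f (x \<otimes> h \<otimes> g [^] j) = d * f (x \<otimes> g [^] j)" if "x \<in> carrier G" for x and j :: nat
        using d[of "x \<otimes> g [^] j"] that g hG by (simp add: m_assoc m_comm[of h])
      then show ?thesis
        by (intro exI[of _ d]) (simp add: sum_distrib_left mult_ac)
    qed
    then show ?case
      using c f(2) by (intro exI[of _ "\<lambda>x. \<Sum>j<order G. c ^ j * f (x \<otimes> g [^] j)"]) auto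
  qed
  from this[OF finite_carrier subset_refl] obtain f u where f: "W f"
    and u: "u \<in> carrier G" "f u \<noteq> 0"
    and "\<And>g. g \<in> carrier G \<Longrightarrow> \<exists>c. \<forall>x\<in>carrier G. f (x \<otimes> g) = c * f x" by blast
  then obtain c where c: "\<And>g x. g \<in> carrier G \<Longrightarrow> x \<in> carrier G \<Longrightarrow> f (x \<otimes> g) = c g * f x"
    by metis
  \<comment> \<open>Every value of \<open>f\<close> is a multiple of \<open>f \<one>\<close>, so
    this value cannot vanish.\<close>
  have f1: "f \<one> \<noteq> 0"
    using c[of u \<one>] u by auto
  have cf: "c g = f g / f \<one>" if "g \<in> carrier G" for g
    using c[of g \<one>] that f1 by simp
  define \<psi> where "\<psi> = (\<lambda>x\<in>carrier G. c x)"
  have mult: "c (x \<otimes> y) = c x * c y" if "x \<in> carrier G" "y \<in> carrier G" for x y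
    using that c[of y x] by (simp add: cf)
  have c1: "c \<one> = 1" using f1 by (simp add: cf)
  have pow: "c (x [^] (k :: nat)) = c x ^ k" if "x \<in> carrier G" for x k
    using that by (induction k) (simp_all add: c1 mult)
  have "c x ^ order G = 1" if "x \<in> carrier G" for x
    using pow[of x "order G"] that by (simp add: pow_order_eq_1 c1)
  then have "\<psi> \<in> characters"
    by (auto simp: characters_def \<psi>_def mult)
  \<comment> \<open>\<open>\<psi>\<close> agrees with \<open>f\<close> divided by
    \<open>f \<one>\<close> on the carrier only, which is where \<open>cong\<close> enters.\<close>
  moreover have "W \<psi>"
    by (rule cong[OF lin[OF f f, of "1 / f \<one>" 0]]) (simp add: \<psi>_def cf)
  ultimately show ?thesis by blast
qed

section \<open>Separation and orthogonality of characters\<close>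

lemma character_separates:
  assumes x: "x \<in> carrier G" "x \<noteq> \<one>"
  obtains \<psi> where "\<psi> \<in> characters" "\<psi> x \<noteq> 1"
proof -
  \<comment> \<open>A character lying in \<open>W\<close> cannot be trivial on the subgroup generated by \<open>x\<close>.\<close>
  define W where "W f \<longleftrightarrow> (\<forall>y\<in>carrier G. (\<Sum>j<order G. f (y \<otimes> x [^] j)) = 0)"
    for f :: "'a \<Rightarrow> complex"
  define \<delta> :: "'a \<Rightarrow> complex" where "\<delta> y = (if y = \<one> then 1 else 0)" for y
  \<comment> \<open>A function minus its translate by \<open>x\<close> telescopes to 0 along the
    powers of \<open>x\<close>; since \<open>x\<close> is not the identity, this one is a nonzero
    member of \<open>W\<close>.\<close>
  have "W (\<lambda>y. \<delta> y - \<delta> (y \<otimes> x))"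
    unfolding W_def
  proof
    fix y assume y: "y \<in> carrier G"
    have "(\<Sum>j<order G. \<delta> (y \<otimes> x [^] j) - \<delta> (y \<otimes> x [^] j \<otimes> x))
        = (\<Sum>j<order G. \<delta> (y \<otimes> x [^] j) - \<delta> (y \<otimes> x [^] Suc j))"
      using x y by (simp add: m_assoc)
    also have "\<dots> = \<delta> (y \<otimes> x [^] (0 :: nat)) - \<delta> (y \<otimes> x [^] order G)"
      by (rule sum_lessThan_telescope')
    also have "\<dots> = 0"
      using x y by (simp add: pow_order_eq_1)
    finally show "(\<Sum>j<order G. \<delta> (y \<otimes> x [^] j) - \<delta> (y \<otimes> x [^] j \<otimes> x)) = 0" .
  qed
  moreover have "\<delta> \<one> - \<delta> (\<one> \<otimes> x) \<noteq> 0"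
    using x by (simp add: \<delta>_def)
  moreover have "W (\<lambda>y. a * f y + b * h y)" if "W f" "W h" for f h a b
    using that by (simp add: W_def sum.distrib flip: sum_distrib_left)
  moreover have "W (\<lambda>y. f (y \<otimes> g))" if "W f" "g \<in> carrier G" for f g
    unfolding W_def
  proof
    fix y assume y: "y \<in> carrier G"
    have "(\<Sum>j<order G. f (y \<otimes> x [^] j \<otimes> g)) = (\<Sum>j<order G. f (y \<otimes> g \<otimes> x [^] j))"
      using x y that by (simp add: m_assoc m_comm[of g])
    then show "(\<Sum>j<order G. f (y \<otimes> x [^] j \<otimes> g)) = 0"
      using that y by (simp add: W_def)
  qed
  moreover have "W h" if "W f" "\<And>y. y \<in> carrier G \<Longrightarrow> f y = h y" for f h
    using that x by (simp add: W_def)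
  ultimately obtain \<psi> where \<psi>: "\<psi> \<in> characters" "W \<psi>"
    using translation_invariant_contains_character[of W "\<lambda>y. \<delta> y - \<delta> (y \<otimes> x)" \<one>] by blast
  have "\<psi> x \<noteq> 1"
  proof
    assume "\<psi> x = 1"
    then have "(\<Sum>j<order G. \<psi> (\<one> \<otimes> x [^] j)) = of_nat (order G)"
      using x \<psi> by (simp add: character_pow)
    then show False using \<psi>(2) order_pos by (simp add: W_def)
  qed
  then show ?thesis using that \<psi> by blast
qed

text \<open>Multiplication by a character \<open>\<phi>\<close> with \<open>\<phi> x\<close>
  different from 1 permutes the characters and scales the sum by \<open>\<phi> x\<close>.\<close>

lemma sum_characters_eq_0:
  assumes x: "x \<in> carrier G" "x \<noteq> \<one>"
  shows "(\<Sum>\<psi>\<in>characters. \<psi> x) = 0"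
proof -
  obtain \<phi> where \<phi>: "\<phi> \<in> characters" "\<phi> x \<noteq> 1"
    using character_separates[OF x] .
  define m where "m \<psi> = (\<lambda>y\<in>carrier G. \<phi> y * \<psi> y)" for \<psi>
  have m: "m \<psi> \<in> characters" if "\<psi> \<in> characters" for \<psi>
    using that \<phi>(1)
    by (auto simp: characters_def m_def power_mult_distrib PiE_def Pi_def)
  have inj: "inj_on m characters"
  proof (rule inj_onI)
    fix \<psi> \<psi>' assume *: "\<psi> \<in> characters" "\<psi>' \<in> characters" "m \<psi> = m \<psi>'"
    have "\<psi> y = \<psi>' y" if "y \<in> carrier G" for y
      using fun_cong[OF *(3), of y] that character_nonzero[OF \<phi>(1) that] by (simp add: m_def)
    then show "\<psi> = \<psi>'"
      using * by (auto simp: characters_def intro: PiE_ext)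
  qed
  have "m ` characters = characters"
    using inj m by (intro endo_inj_surj) auto
  then have "(\<Sum>\<psi>\<in>characters. \<psi> x) = (\<Sum>\<psi>\<in>characters. m \<psi> x)"
    using sum.reindex[OF inj, of "\<lambda>\<psi>. \<psi> x"] by simp
  also have "\<dots> = \<phi> x * (\<Sum>\<psi>\<in>characters. \<psi> x)"
    using x by (simp add: m_def sum_distrib_left)
  finally show ?thesis using \<phi>(2) by simp
qed

lemma sum_group_translate:
  fixes f :: "'a \<Rightarrow> 'c :: comm_monoid_add"
  assumes "g \<in> carrier G"
  shows "(\<Sum>x\<in>carrier G. f (x \<otimes> g)) = (\<Sum>x\<in>carrier G. f x)"
  by (rule sum.reindex_bij_witness[of _ "\<lambda>x. x \<otimes> inv g" "\<lambda>x. x \<otimes> g"])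
    (use assms in \<open>auto simp: m_assoc\<close>)

text \<open>Double counting of the sum of all \<open>\<psi> x\<close>: summed over characters first,
  only the identity contributes; summed over the group first, only the trivial character
  does.\<close>

lemma card_characters: "card characters = order G"
proof -
  define \<phi> :: "'a \<Rightarrow> complex" where "\<phi> = (\<lambda>x\<in>carrier G. 1)"
  have \<phi>: "\<phi> \<in> characters"
    by (auto simp: characters_def \<phi>_def)
  have zero: "(\<Sum>x\<in>carrier G. \<psi> x) = 0" if \<psi>: "\<psi> \<in> characters" "\<psi> \<noteq> \<phi>" for \<psi>
  proof -
    have "\<exists>g\<in>carrier G. \<psi> g \<noteq> 1"
    proof (rule ccontr)
      assume "\<not> (\<exists>g\<in>carrier G. \<psi> g \<noteq> 1)"
      then have "\<psi> = \<phi>"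
        using \<psi>(1) by (auto simp: characters_def \<phi>_def PiE_def extensional_def)
      then show False using \<psi> by simp
    qed
    then obtain g where g: "g \<in> carrier G" "\<psi> g \<noteq> 1" by blast
    have "(\<Sum>x\<in>carrier G. \<psi> x) = (\<Sum>x\<in>carrier G. \<psi> (x \<otimes> g))"
      using sum_group_translate[OF g(1), of \<psi>] by simp
    also have "\<dots> = \<psi> g * (\<Sum>x\<in>carrier G. \<psi> x)"
      using g \<psi> by (simp add: character_mult sum_distrib_left mult.commute)
    finally show ?thesis using g(2) by simp
  qed
  have "of_nat (card characters) = (\<Sum>\<psi>\<in>characters. \<psi> \<one>)"
    by (simp add: character_one)
  also have "\<dots> = (\<Sum>x\<in>carrier G. \<Sum>\<psi>\<in>characters. \<psi> x)"
    by (subst sum.remove[of _ \<one>]) (auto simp: sum_characters_eq_0)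
  also have "\<dots> = (\<Sum>\<psi>\<in>characters. \<Sum>x\<in>carrier G. \<psi> x)"
    by (rule sum.swap)
  also have "\<dots> = (\<Sum>x\<in>carrier G. \<phi> x)"
    using \<phi> zero by (subst sum.remove[of _ \<phi>]) auto
  also have "\<dots> = of_nat (order G)"
    by (simp add: \<phi>_def Coset.order_def)
  finally have "(of_nat (card characters) :: complex) = of_nat (order G)" .
  then show ?thesis using of_nat_eq_iff by blast
qed

lemma sum_characters:
  assumes "x \<in> carrier G"
  shows "(\<Sum>\<psi>\<in>characters. \<psi> x) = (if x = \<one> then of_nat (order G) else 0)"
  using assms sum_characters_eq_0 by (simp add: character_one card_characters)

lemma pow_coprime_eq_one:
  assumes "x \<in> carrier G" "coprime k (order G)" "x [^] (k :: nat) = \<one>"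
  shows "x = \<one>"
proof -
  have "ord x dvd k" "ord x dvd order G"
    using assms by (auto simp: pow_eq_id ord_dvd_group_order)
  then have "ord x = 1"
    using assms(2) coprime_common_divisor_nat by blast
  then show ?thesis
    using assms(1) ord_eq_1 by blast
qed

lemma bij_betw_pow:
  assumes "coprime k (order G)"
  shows "bij_betw (\<lambda>x. x [^] (k :: nat)) (carrier G) (carrier G)"
proof -
  have "inj_on (\<lambda>x. x [^] k) (carrier G)"
  proof (rule inj_onI)
    fix x y assume xy: "x \<in> carrier G" "y \<in> carrier G" "x [^] k = y [^] k"
    have "(x \<otimes> inv y) [^] k = \<one>"
      using xy by (simp add: pow_mult_distrib m_comm nat_pow_inv)
    then have "x \<otimes> inv y = \<one>"
      using pow_coprime_eq_one[OF _ assms] xy by simp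
    moreover have "x = x \<otimes> inv y \<otimes> y" using xy by (simp add: m_assoc)
    ultimately show "x = y" using xy by simp
  qed
  moreover from this have "(\<lambda>x. x [^] k) ` carrier G = carrier G"
    by (intro endo_inj_surj) auto
  ultimately show ?thesis by (simp add: bij_betw_def)
qed

end

section \<open>Eigenvalues of oriented Cayley graphs\<close>

definition omega3 :: complex where
  "omega3 = Complex (- 1 / 2) (sqrt 3 / 2)"

lemma omega3_square: "omega3 ^ 2 = Complex (- 1 / 2) (- sqrt 3 / 2)"
  by (simp add: omega3_def complex_eq_iff power2_eq_square)

lemma omega3_cube: "omega3 ^ 3 = 1"
  unfolding power3_eq_cube power2_eq_square[symmetric] omega3_square
  by (simp add: omega3_def complex_eq_iff)

lemma omega3_neq: "omega3 \<noteq> 0" "omega3 ^ 2 \<noteq> 0" "omega3 ^ 2 \<noteq> omega3"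
  by (auto simp: omega3_square) (auto simp: omega3_def complex_eq_iff)

text \<open>The entries of the Hermitian adjacency matrix are \<open>- omega3\<^sup>2\<close>, \<open>- omega3\<close> and \<open>0\<close>; dropping the sign
  turns sixth roots of unity into cube roots, so that \<open>p = 2\<close> is not a special prime.\<close>

definition skew_weight :: "('a, 'b) monoid_scheme \<Rightarrow> 'a set \<Rightarrow> 'a \<Rightarrow> complex" where
  "skew_weight G S x =
     (if x \<in> S then omega3 ^ 2 else if inv\<^bsub>G\<^esub> x \<in> S then omega3 else 0)"

lemma skew_weight_cases:
  "skew_weight G S x = 0 \<or> skew_weight G S x = omega3 \<or> skew_weight G S x = omega3 ^ 2"
  by (simp add: skew_weight_def)

lemma skew_weight_eq_iff: "skew_weight G S x = omega3 ^ 2 \<longleftrightarrow> x \<in> S"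
  using omega3_neq by (auto simp: skew_weight_def)

lemma skew_weight_root_unity: "skew_weight G S x = 0 \<or> skew_weight G S x ^ 3 = 1"
proof -
  have "(omega3 ^ 2) ^ 3 = (omega3 ^ 3) ^ 2" by (simp flip: power_mult)
  then show ?thesis
    using skew_weight_cases[of G S x] omega3_cube by auto
qed

text \<open>A weight is 0 or a cube root of unity; positive exponents keep \<open>0 ^ 0 = 1\<close>
  out.\<close>

lemma skew_weight_power_cong:
  assumes "[k = l] (mod 3)" "k > 0" "l > 0"
  shows "skew_weight G S x ^ k = skew_weight G S x ^ l"
proof (cases "skew_weight G S x = 0")
  case False
  then have 1: "skew_weight G S x ^ 3 = 1" using skew_weight_root_unity[of G S x] by simp
  have "skew_weight G S x ^ j = skew_weight G S x ^ (j mod 3)" for j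
  proof -
    have "skew_weight G S x ^ j = skew_weight G S x ^ (3 * (j div 3) + j mod 3)" by simp
    then show ?thesis unfolding power_add power_mult 1 by simp
  qed
  from this[of k] this[of l] show ?thesis using assms(1) by (simp add: cong_def)
qed (use assms in \<open>simp add: zero_power\<close>)

lemma omega3_pow4: "(omega3 ^ 2) ^ 2 = omega3"
proof -
  have "(omega3 ^ 2) ^ 2 = omega3 ^ 3 * omega3"
    by (simp add: eval_nat_numeral)
  then show ?thesis by (simp add: omega3_cube)
qed

lemma skew_weight_power_cases:
  assumes "coprime k 3"
  shows "skew_weight G S x ^ k \<in> {0, omega3, omega3 ^ 2}"
proof -
  have k0: "k > 0" using assms by (cases k) auto
  consider "k mod 3 = 1" | "k mod 3 = 2" using coprime_3_mod[OF assms] by blast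
  then have "skew_weight G S x ^ k = skew_weight G S x \<or>
      skew_weight G S x ^ k = skew_weight G S x ^ 2"
    using skew_weight_power_cong[of k 1 G S x] skew_weight_power_cong[of k 2 G S x] k0
    by (cases; simp add: cong_def)
  then show ?thesis
    using skew_weight_cases[of G S x] omega3_pow4 k0 by (auto simp: zero_power)
qed

text \<open>A nonzero difference is, up to sign, either a cube root of unity, inverted by another
  one, or \<open>omega3 - omega3 ^ 2\<close>, whose product with its conjugate is 3. The cofactor is
  again a difference of such values, hence in the cyclotomic ring.\<close>

lemma omega3_diff_times_diff:
  fixes a b :: complex
  assumes "a \<in> {0, omega3, omega3 ^ 2}" "b \<in> {0, omega3, omega3 ^ 2}" "a \<noteq> b"
  shows "\<exists>c\<in>{0, omega3, omega3 ^ 2}. \<exists>d\<in>{0, omega3, omega3 ^ 2}. (a - b) * (c - d) \<in> {1, 3}"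
proof -
  have 1: "omega3 * omega3 ^ 2 = 1" using omega3_cube by (simp add: power2_eq_square power3_eq_cube mult.assoc)
  have 2: "(omega3 - omega3 ^ 2) * (omega3 ^ 2 - omega3) = 3"
    unfolding omega3_square by (simp add: omega3_def complex_eq_iff)
  show ?thesis
    using assms omega3_neq 1 2 by (auto simp: algebra_simps)
qed

section \<open>The spectrum in terms of characters\<close>

context finite_abelian_group
begin

lemma hermitian_adjacency2_Cay:
  assumes "skew_symmetric G S" "u \<in> carrier G" "v \<in> carrier G"
  shows "hermitian_adjacency2 (Cay G S) u v = - skew_weight G S (v \<otimes> inv u)"
proof -
  have "inv (v \<otimes> inv u) = u \<otimes> inv v"
    using assms by (simp add: inv_mult m_comm)
  moreover have "(1 + \<i> * sqrt 3) / 2 = - (omega3 ^ 2)" "(1 - \<i> * sqrt 3) / 2 = - omega3"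
    unfolding omega3_square by (simp_all add: omega3_def complex_eq_iff)
  \<comment> \<open>Skew-symmetry excludes pairs of opposite arcs, so the entry 1 never
    occurs.\<close>
  moreover have "\<not> (v \<otimes> inv u \<in> S \<and> inv (v \<otimes> inv u) \<in> S)"
    using assms(1) by (auto simp: skew_symmetric_def)
  ultimately show ?thesis
    using assms(2,3) by (simp add: hermitian_adjacency2_def Cay_def skew_weight_def)
qed

lemma hermitian_adjacency2_Cay_sum:
  assumes "skew_symmetric G S" "u \<in> carrier G"
  shows "(\<Sum>v\<in>carrier G. hermitian_adjacency2 (Cay G S) u v * f v)
    = - (\<Sum>x\<in>carrier G. skew_weight G S x * f (x \<otimes> u))"
proof -
  have "(\<Sum>v\<in>carrier G. hermitian_adjacency2 (Cay G S) u v * f v)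
      = (\<Sum>x\<in>carrier G. hermitian_adjacency2 (Cay G S) u (x \<otimes> u) * f (x \<otimes> u))"
    by (rule sum_group_translate[symmetric]) fact
  also have "\<dots> = (\<Sum>x\<in>carrier G. - (skew_weight G S x * f (x \<otimes> u)))"
    using assms by (intro sum.cong refl) (simp add: hermitian_adjacency2_Cay m_assoc)
  finally show ?thesis by (simp add: sum_negf)
qed

text \<open>The matrix acts as a convolution with the weight, so each eigenspace is translation
  invariant and contains a character. Evaluating the eigenvector equation at the identity, where a
  character is 1, yields the eigenvalue.\<close>

lemma eigenvalue_on_Cay_iff:
  assumes "skew_symmetric G S"
  shows "eigenvalue_on (carrier G) (hermitian_adjacency2 (Cay G S)) k
    \<longleftrightarrow> (\<exists>\<psi>\<in>characters. k = - (\<Sum>x\<in>carrier G. skew_weight G S x * \<psi> x))"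
proof
  assume "\<exists>\<psi>\<in>characters. k = - (\<Sum>x\<in>carrier G. skew_weight G S x * \<psi> x)"
  then obtain \<psi> where \<psi>: "\<psi> \<in> characters"
    and k: "k = - (\<Sum>x\<in>carrier G. skew_weight G S x * \<psi> x)" by blast
  have "eigenvector_on (carrier G) (hermitian_adjacency2 (Cay G S)) \<psi> k"
    unfolding eigenvector_on_def
  proof (intro conjI ballI)
    show "\<exists>u\<in>carrier G. \<psi> u \<noteq> 0" using \<psi> character_nonzero by blast
    fix u assume u: "u \<in> carrier G"
    show "(\<Sum>v\<in>carrier G. hermitian_adjacency2 (Cay G S) u v * \<psi> v) = k * \<psi> u"
      unfolding hermitian_adjacency2_Cay_sum[OF assms u] k
      using u \<psi> by (simp add: character_mult sum_distrib_right mult.assoc)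
  qed
  then show "eigenvalue_on (carrier G) (hermitian_adjacency2 (Cay G S)) k"
    by (auto simp: eigenvalue_on_def)
next
  assume "eigenvalue_on (carrier G) (hermitian_adjacency2 (Cay G S)) k"
  then obtain f where "eigenvector_on (carrier G) (hermitian_adjacency2 (Cay G S)) f k"
    by (auto simp: eigenvalue_on_def)
  then obtain u where u: "u \<in> carrier G" "f u \<noteq> 0"
    and f: "\<And>u. u \<in> carrier G \<Longrightarrow> - (\<Sum>x\<in>carrier G. skew_weight G S x * f (x \<otimes> u)) = k * f u"
    by (auto simp: eigenvector_on_def hermitian_adjacency2_Cay_sum[OF assms])
  define W where "W f \<longleftrightarrow> (\<forall>u\<in>carrier G.
    (\<Sum>x\<in>carrier G. skew_weight G S x * f (x \<otimes> u)) = - k * f u)" for f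
  have lin: "W (\<lambda>y. a * f y + b * h y)" if "W f" "W h" for f h a b
    unfolding W_def
  proof
    fix u assume u: "u \<in> carrier G"
    have "(\<Sum>x\<in>carrier G. skew_weight G S x * (a * f (x \<otimes> u) + b * h (x \<otimes> u)))
        = a * (\<Sum>x\<in>carrier G. skew_weight G S x * f (x \<otimes> u))
          + b * (\<Sum>x\<in>carrier G. skew_weight G S x * h (x \<otimes> u))"
      by (simp add: sum_distrib_left sum.distrib algebra_simps)
    also have "\<dots> = - k * (a * f u + b * h u)"
      using that u by (simp add: W_def algebra_simps)
    finally show "(\<Sum>x\<in>carrier G. skew_weight G S x * (a * f (x \<otimes> u) + b * h (x \<otimes> u)))
        = - k * (a * f u + b * h u)" .
  qed
  have trans: "W (\<lambda>y. f (y \<otimes> g))" if "W f" "g \<in> carrier G" for f g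
    using that by (simp add: W_def m_assoc)
  have cong: "W h" if "W f" "\<And>y. y \<in> carrier G \<Longrightarrow> f y = h y" for f h
    using that by (simp add: W_def)
  have Wf: "W f"
    unfolding W_def by (simp flip: f)
  have "\<exists>\<psi>\<in>characters. W \<psi>"
    by (rule translation_invariant_contains_character[of W f u])
      (fact lin, fact trans, fact cong, fact Wf, fact u, fact u)
  then obtain \<psi> where \<psi>: "\<psi> \<in> characters" "W \<psi>" by blast
  then have "(\<Sum>x\<in>carrier G. skew_weight G S x * \<psi> (x \<otimes> \<one>)) = - k * \<psi> \<one>"
    unfolding W_def by blast
  then have "(\<Sum>x\<in>carrier G. skew_weight G S x * \<psi> x) = - k"
    using \<psi>(1) by (simp add: character_one)
  then show "\<exists>\<psi>\<in>characters. k = - (\<Sum>x\<in>carrier G. skew_weight G S x * \<psi> x)"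
    using \<psi>(1) by (intro bexI[of _ \<psi>]) simp_all
qed

lemma HS_integral_Cay_iff:
  assumes "skew_symmetric G S"
  shows "HS_integral (Cay G S)
    \<longleftrightarrow> (\<forall>\<psi>\<in>characters. (\<Sum>x\<in>carrier G. skew_weight G S x * \<psi> x) \<in> \<int>)"
proof -
  have "pverts (Cay G S) = carrier G" by (simp add: Cay_def)
  moreover have "- z \<in> \<int> \<longleftrightarrow> z \<in> \<int>" for z :: complex
    using Ints_minus[of z] Ints_minus[of "- z"] by auto
  ultimately show ?thesis
    unfolding HS_integral_def by (auto simp: eigenvalue_on_Cay_iff[OF assms])
qed

section \<open>Integral character sums and compatibility of the weight with powers\<close>

lemma omega3_in_cyclotomic_ring:
  "c \<in> {0, omega3, omega3 ^ 2} \<Longrightarrow> c \<in> cyclotomic_ring (3 * order G)"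
proof -
  have "omega3 ^ (3 * order G) = 1" by (simp add: power_mult omega3_cube)
  then have "omega3 \<in> cyclotomic_ring (3 * order G)"
    using order_pos by (intro root_unity_in_cyclotomic_ring) auto
  then show "c \<in> {0, omega3, omega3 ^ 2} \<Longrightarrow> c \<in> cyclotomic_ring (3 * order G)"
    using cyclotomic_ring_power[of "3 * order G" omega3 2] cyclotomic_ring_0 order_pos by auto
qed

lemma weight_in_cyclotomic_ring: "skew_weight G S x \<in> cyclotomic_ring (3 * order G)"
  using skew_weight_cases[of G S x] by (intro omega3_in_cyclotomic_ring) simp

lemma character_in_cyclotomic_ring:
  assumes "\<psi> \<in> characters" "x \<in> carrier G"
  shows "\<psi> x \<in> cyclotomic_ring (3 * order G)"
proof (rule root_unity_in_cyclotomic_ring)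
  have "\<psi> x ^ (order G * 3) = 1"
    using character_root_unity[OF assms] by (simp add: power_mult)
  then show "\<psi> x ^ (3 * order G) = 1" by (simp add: mult.commute)
qed (use order_pos in simp)

lemma integral_imp_weight_prime_power:
  assumes int: "\<And>\<psi>. \<psi> \<in> characters \<Longrightarrow> (\<Sum>x\<in>carrier G. skew_weight G S x * \<psi> x) \<in> \<int>"
    and p: "prime p" "coprime p (3 * order G)" and t: "t \<in> carrier G"
  shows "skew_weight G S (t [^] p) = skew_weight G S t ^ p"
proof (rule ccontr)
  let ?w = "skew_weight G S" and ?A = "cyclotomic_ring (3 * order G)"
  have N: "3 * order G > 0" using order_pos by simp
  have pn: "coprime p (order G)" using p(2) by simp
  have p0: "p > 0" using p(1) prime_gt_0_nat by blast
  \<comment> \<open>The character sum minus its image under the Frobenius map, divided by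
    \<open>p\<close>. Fermat's theorem and the Frobenius congruence place it in the ring.\<close>
  define q where "q \<psi> = ((\<Sum>x\<in>carrier G. ?w x * \<psi> x)
    - (\<Sum>x\<in>carrier G. ?w x ^ p * \<psi> (x [^] p))) / of_nat p" for \<psi>
  have q: "q \<psi> \<in> ?A" if \<psi>: "\<psi> \<in> characters" for \<psi>
  proof -
    obtain m where m: "(\<Sum>x\<in>carrier G. ?w x * \<psi> x) = of_int m"
      using int[OF \<psi>] by (auto elim: Ints_cases)
    obtain e where e: "m ^ p - m = int p * e"
      using fermat_int[OF p(1)] by (auto elim: dvdE)
    then have "(of_int m ^ p - of_int m :: complex) = of_nat p * of_int e"
      by (metis of_int_diff of_int_mult of_int_of_nat_eq of_int_power)
    moreover obtain r where r: "r \<in> ?A"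
      "(\<Sum>x\<in>carrier G. ?w x * \<psi> x) ^ p = (\<Sum>x\<in>carrier G. (?w x * \<psi> x) ^ p) + of_nat p * r"
      using cyclotomic_ring_frobenius_sum[OF N p(1) finite_carrier, of "\<lambda>x. ?w x * \<psi> x"]
        cyclotomic_ring_mult[OF N weight_in_cyclotomic_ring character_in_cyclotomic_ring[OF \<psi>]]
      by blast
    moreover have "(\<Sum>x\<in>carrier G. (?w x * \<psi> x) ^ p) = (\<Sum>x\<in>carrier G. ?w x ^ p * \<psi> (x [^] p))"
      using \<psi> by (intro sum.cong refl) (simp add: power_mult_distrib character_pow)
    ultimately have "(\<Sum>x\<in>carrier G. ?w x * \<psi> x) - (\<Sum>x\<in>carrier G. ?w x ^ p * \<psi> (x [^] p))
        = of_nat p * (r - of_int e)"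
      unfolding m by (simp add: algebra_simps)
    then have "q \<psi> = r - of_int e"
      using p0 by (simp add: q_def)
    then show ?thesis
      using cyclotomic_ring_diff[OF r(1) cyclotomic_ring_of_int[OF N]] by simp
  qed
  define s where "s = inv (t [^] p)"
  have s: "s \<in> carrier G" using t by (simp add: s_def)
  define Q where "Q = (\<Sum>\<psi>\<in>characters. q \<psi> * \<psi> s)"
  have Q: "Q \<in> ?A"
    unfolding Q_def using q s
    by (intro cyclotomic_ring_sum cyclotomic_ring_mult[OF N])
      (auto intro: character_in_cyclotomic_ring)
  \<comment> \<open>Fourier inversion at \<open>t [^] p\<close> with a substitution \<open>g\<close>
    that takes this value only at \<open>y\<close>. It serves both for the identity, with
    \<open>y = t [^] p\<close>, and for the \<open>p\<close>-th power map, with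
    \<open>y = t\<close>.\<close>
  have fourier: "(\<Sum>\<psi>\<in>characters. (\<Sum>x\<in>carrier G. a x * \<psi> (g x)) * \<psi> s) = of_nat (order G) * a y"
    if g: "\<And>x. x \<in> carrier G \<Longrightarrow> g x \<in> carrier G" and y: "y \<in> carrier G"
      and gy: "\<And>x. x \<in> carrier G \<Longrightarrow> g x = t [^] p \<longleftrightarrow> x = y" for a :: "'a \<Rightarrow> complex" and g y
  proof -
    have gs: "g x \<otimes> s = \<one> \<longleftrightarrow> x = y" if "x \<in> carrier G" for x
      using that g[OF that] gy[OF that] t s unfolding s_def
      by (metis inv_equality inv_inv nat_pow_closed r_inv)
    have "(\<Sum>\<psi>\<in>characters. (\<Sum>x\<in>carrier G. a x * \<psi> (g x)) * \<psi> s)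
        = (\<Sum>\<psi>\<in>characters. \<Sum>x\<in>carrier G. a x * \<psi> (g x \<otimes> s))"
      using g s by (simp add: sum_distrib_right character_mult mult.assoc)
    also have "\<dots> = (\<Sum>x\<in>carrier G. a x * (\<Sum>\<psi>\<in>characters. \<psi> (g x \<otimes> s)))"
      by (subst sum.swap) (simp add: sum_distrib_left)
    also have "\<dots> = (\<Sum>x\<in>carrier G. if x = y then of_nat (order G) * a y else 0)"
      using g s by (intro sum.cong refl) (auto simp: sum_characters gs)
    also have "\<dots> = of_nat (order G) * a y"
      using y by simp
    finally show ?thesis .
  qed
  have "of_nat (order G) * ?w (t [^] p) - of_nat (order G) * ?w t ^ p
      = (\<Sum>\<psi>\<in>characters. (\<Sum>x\<in>carrier G. ?w x * \<psi> x) * \<psi> s)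
        - (\<Sum>\<psi>\<in>characters. (\<Sum>x\<in>carrier G. ?w x ^ p * \<psi> (x [^] p)) * \<psi> s)"
    using fourier[of "\<lambda>x. x" "t [^] p" ?w] fourier[of "\<lambda>x. x [^] p" t "\<lambda>x. ?w x ^ p"] t
      inj_on_eq_iff[OF bij_betw_imp_inj_on[OF bij_betw_pow[OF pn]]] by simp
  also have "\<dots> = of_nat p * Q"
    unfolding Q_def sum_distrib_left sum_subtractf[symmetric] left_diff_distrib[symmetric]
    using p0 by (intro sum.cong refl) (simp add: q_def sum_subtractf)
  finally have eq: "of_nat (order G) * (?w (t [^] p) - ?w t ^ p) = of_nat p * Q"
    by (simp add: algebra_simps)

  assume "?w (t [^] p) \<noteq> ?w t ^ p"
  moreover have "?w t ^ p \<in> {0, omega3, omega3 ^ 2}"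
    using p(2) by (intro skew_weight_power_cases) simp
  moreover have "?w (t [^] p) \<in> {0, omega3, omega3 ^ 2}"
    using skew_weight_cases[of G S] by simp
  ultimately obtain c d where cd: "c \<in> {0, omega3, omega3 ^ 2}" "d \<in> {0, omega3, omega3 ^ 2}"
    "(?w (t [^] p) - ?w t ^ p) * (c - d) \<in> {1, 3}"
    using omega3_diff_times_diff by meson
  then obtain b :: nat where b: "b \<in> {1, 3}" "(?w (t [^] p) - ?w t ^ p) * (c - d) = of_nat b"
    by (metis insertE insertI1 insertI2 of_nat_1 of_nat_numeral singletonD)
  \<comment> \<open>Multiplying by \<open>c - d\<close> turns the difference of weights into the
    natural number \<open>b\<close>. Thus \<open>y\<close> is rational as well as in the ring, hence
    an integer, and \<open>p\<close> divides \<open>order G * b\<close>.\<close>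
  define y where "y = Q * (c - d)"
  have "of_nat p * y = of_nat (order G) * ((?w (t [^] p) - ?w t ^ p) * (c - d))"
    using eq by (simp add: y_def mult.assoc[symmetric])
  then have py: "of_nat p * y = of_nat (order G * b)"
    unfolding b by simp
  have "y = of_nat (order G * b) / of_nat p"
    using py p0 by (simp add: field_simps)
  then have "y \<in> \<rat>" by simp
  moreover have "y \<in> ?A"
    unfolding y_def using cd omega3_in_cyclotomic_ring
    by (intro cyclotomic_ring_mult[OF N Q] cyclotomic_ring_diff) auto
  ultimately have "y \<in> \<int>"
    using cyclotomic_ring_rational_imp_int[OF N] by blast
  then obtain z where "y = of_int z" by (auto elim: Ints_cases)
  with py have "(of_int (int p * z) :: complex) = of_int (int (order G * b))" by simp
  then have "int p * z = int (order G * b)" using of_int_eq_iff by blast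
  then have "int p dvd int (order G * b)" by (metis dvd_triv_left)
  then have "p dvd order G * b" by (simp only: int_dvd_int_iff)
  moreover have "order G * b dvd 3 * order G" using b(1) by auto
  ultimately have "p dvd 3 * order G" using dvd_trans by blast
  then show False using p by (metis coprime_absorb_left not_prime_unit)
qed

lemma integral_imp_weight_power:
  assumes int: "\<And>\<psi>. \<psi> \<in> characters \<Longrightarrow> (\<Sum>x\<in>carrier G. skew_weight G S x * \<psi> x) \<in> \<int>"
    and k: "coprime k (3 * order G)" and t: "t \<in> carrier G"
  shows "skew_weight G S (t [^] k) = skew_weight G S t ^ k"
  using k
proof (induction k rule: less_induct)
  case (less k)
  consider "k = 0" | "k = 1" | "k > 1" by linarith
  then show ?case
  proof cases
    case 1
    \<comment> \<open>0 is not coprime to a multiple of 3.\<close>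
    then show ?thesis using less.prems by simp
  next
    case 2
    then show ?thesis using t by simp
  next
    case 3
    then obtain p where p: "prime p" "p dvd k" using prime_factor_nat[of k] by auto
    then obtain l where l: "k = l * p" by (metis dvdE mult.commute)
    have cop: "coprime p (3 * order G)" "coprime l (3 * order G)"
      using less.prems by (auto simp: l)
    have "l > 0" using 3 by (cases l) (auto simp: l)
    then have "l < k" using prime_gt_1_nat[OF p(1)] by (simp add: l)
    have "skew_weight G S (t [^] k) = skew_weight G S ((t [^] l) [^] p)"
      using t by (simp add: l nat_pow_pow)
    also have "\<dots> = skew_weight G S (t [^] l) ^ p"
      using t by (intro integral_imp_weight_prime_power int p cop) auto
    also have "\<dots> = skew_weight G S t ^ k"
      using less.IH[OF \<open>l < k\<close> cop(2)] by (simp add: l power_mult)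
    finally show ?thesis .
  qed
qed

lemma weight_power_imp_integral:
  assumes pow: "\<And>k x. k > 0 \<Longrightarrow> coprime k (3 * order G) \<Longrightarrow> x \<in> carrier G \<Longrightarrow>
      skew_weight G S (x [^] k) = skew_weight G S x ^ k"
    and \<psi>: "\<psi> \<in> characters"
  shows "(\<Sum>x\<in>carrier G. skew_weight G S x * \<psi> x) \<in> \<int>"
proof -
  let ?w = "skew_weight G S"
  define N where "N = 3 * order G"
  define K where "K = {k. k \<in> {1..N} \<and> coprime k N}"
  define \<mu> where "\<mu> = (\<Sum>x\<in>carrier G. ?w x * \<psi> x)"
  have N: "N > 0" using order_pos by (simp add: N_def)
  have fin: "finite K" by (simp add: K_def)
  \<comment> \<open>Each \<open>k\<close> in \<open>K\<close> permutes the group by powers, so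
    \<open>\<mu>\<close> equals its own \<open>k\<close>-th conjugate.\<close>
  have "(\<Sum>x\<in>carrier G. (?w x * \<psi> x) ^ k) = \<mu>" if k: "k \<in> K" for k
  proof -
    have k': "k > 0" "coprime k (3 * order G)" "coprime k (order G)"
      using k by (auto simp: K_def N_def)
    have "(\<Sum>x\<in>carrier G. (?w x * \<psi> x) ^ k) = (\<Sum>x\<in>carrier G. ?w (x [^] k) * \<psi> (x [^] k))"
      using k' pow \<psi> by (intro sum.cong refl) (simp add: power_mult_distrib character_pow)
    also have "\<dots> = \<mu>"
      unfolding \<mu>_def using bij_betw_pow[OF k'(3)] by (rule sum.reindex_bij_betw)
    finally show ?thesis .
  qed
  then have "of_nat (card K) * \<mu> = (\<Sum>k\<in>K. \<Sum>x\<in>carrier G. (?w x * \<psi> x) ^ k)"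
    by simp
  also have "\<dots> = (\<Sum>x\<in>carrier G. \<Sum>k\<in>K. (?w x * \<psi> x) ^ k)"
    by (rule sum.swap)
  also have "\<dots> \<in> \<int>"
  proof (rule Ints_sum)
    fix x assume x: "x \<in> carrier G"
    show "(\<Sum>k\<in>K. (?w x * \<psi> x) ^ k) \<in> \<int>"
    \<comment> \<open>A zero weight contributes 0 because all \<open>k\<close> in \<open>K\<close>
      are positive; otherwise \<open>?w x * \<psi> x\<close> is an \<open>N\<close>-th root of unity
      and its powers form a Ramanujan sum.\<close>
    proof (cases "?w x = 0")
      case True
      then have "(\<Sum>k\<in>K. (?w x * \<psi> x) ^ k) = 0"
        by (intro sum.neutral) (auto simp: K_def)
      then show ?thesis by simp
    next
      case False
      then have "?w x ^ (3 * order G) = 1"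
        using skew_weight_root_unity[of G S x] by (simp add: power_mult)
      moreover have "\<psi> x ^ (order G * 3) = 1"
        using character_root_unity[OF \<psi> x] by (simp add: power_mult)
      ultimately have "(?w x * \<psi> x) ^ N = 1"
        by (simp add: N_def power_mult_distrib mult.commute)
      then show ?thesis
        unfolding K_def by (rule ramanujan_sum_int[OF N])
    qed
  qed
  finally obtain m where m: "of_nat (card K) * \<mu> = of_int m"
    by (auto elim: Ints_cases)
  have "1 \<in> K" using N by (simp add: K_def)
  then have "card K \<noteq> 0" using fin by auto
  then have "\<mu> = of_int m / of_nat (card K)"
    using m by (simp add: field_simps)
  then have "\<mu> \<in> \<rat>" by simp
  moreover have "\<mu> \<in> cyclotomic_ring N"
    unfolding \<mu>_def N_def using order_pos \<psi>
    by (intro cyclotomic_ring_sum cyclotomic_ring_mult weight_in_cyclotomic_ring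
        character_in_cyclotomic_ring) auto
  ultimately show ?thesis
    using cyclotomic_ring_rational_imp_int[OF N] by (simp add: \<mu>_def)
qed

section \<open>Compatibility of the weight with powers and membership in \<open>EE\<close>\<close>

lemma skew_weight_inv:
  assumes "skew_symmetric G S" "x \<in> carrier G"
  shows "skew_weight G S (inv x) = skew_weight G S x ^ 2"
  using assms omega3_pow4 by (auto simp: skew_weight_def skew_symmetric_def)

text \<open>Powers with exponent 1 modulo 3 preserve the weight, so \<open>S\<close> contains
  \<open>dbl_angle G x\<close> for each of its elements \<open>x\<close>, and \<open>S\<close>
  itself can serve as the set of generators.\<close>

lemma weight_power_imp_EE:
  assumes S: "S \<subseteq> carrier G" "skew_symmetric G S"
    and pow: "\<And>k x. k > 0 \<Longrightarrow> coprime k (3 * order G) \<Longrightarrow> x \<in> carrier G \<Longrightarrow>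
      skew_weight G S (x [^] k) = skew_weight G S x ^ k"
  shows "S \<in> EE G"
proof -
  have closed: "x [^] k \<in> S" if x: "x \<in> S" and k: "coprime k (ord x)" "[k = 1] (mod 3)"
    for x and k :: nat
  proof -
    have xG: "x \<in> carrier G" using x S by blast
    have "coprime k 3"
      using k(2) by (metis cong_imp_coprime cong_sym coprime_1_left)
    then have "coprime k (3 * ord x)" using k(1) by simp
    \<comment> \<open>\<open>pow\<close> speaks about exponents coprime to the group order, while
      \<open>k\<close> is only coprime to the order of \<open>x\<close>; the lift changes neither
      the power of \<open>x\<close> nor the residue modulo 3.\<close>
    then obtain l where l: "[l = k] (mod 3 * ord x)" "coprime l (3 * order G)" "l > 0"
      using coprime_lift[of k "3 * ord x" "3 * order G"] order_pos by auto
    have "[l = 1] (mod 3)"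
      using l(1) k(2) by (meson cong_dvd_modulus_nat cong_trans dvd_triv_left)
    then have "skew_weight G S (x [^] l) = omega3 ^ 2"
      using pow[OF l(3,2) xG] skew_weight_power_cong[of l 1 G S x] l(3) x
      by (simp add: skew_weight_eq_iff)
    then have "x [^] l \<in> S" by (simp add: skew_weight_eq_iff)
    moreover have "[l = k] (mod ord x)"
      using l(1) cong_dvd_modulus_nat dvd_triv_right by blast
    then have "x [^] l = x [^] k" using xG pow_cong_ord by simp
    ultimately show ?thesis by simp
  qed
  have div3: "3 dvd ord x" if x: "x \<in> S" for x
  proof (rule ccontr)
    assume "\<not> 3 dvd ord x"
    have xG: "x \<in> carrier G" using x S by blast
    have o: "ord x \<ge> 1" using ord_ge_1[OF finite_carrier xG] .
    have "coprime 3 (ord x)"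
      using \<open>\<not> 3 dvd ord x\<close> by (intro prime_imp_coprime) auto
    \<comment> \<open>An exponent that is 1 modulo 3 and -1 modulo \<open>ord x\<close> would put
      the inverse of \<open>x\<close> into \<open>S\<close>, against skew-symmetry.\<close>
    then obtain k where k: "[k = 1] (mod 3)" "[k = ord x - 1] (mod ord x)"
      using binary_chinese_remainder_nat[of 3 "ord x" 1 "ord x - 1"] by blast
    have "ord x dvd k + 1"
      using k(2) o by (metis Suc_eq_plus1 cong_0_iff cong_add_rcancel_nat cong_dvd_iff dvd_refl le_add_diff_inverse2)
    then have "x [^] (k + 1) = \<one>" using xG pow_eq_id by blast
    then have "x [^] k = inv x"
      using xG by (intro inv_equality[symmetric]) simp_all
    moreover have "coprime k (ord x)"
      using \<open>ord x dvd k + 1\<close> by (metis coprime_add_one_right coprime_divisors dvd_refl)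
    then have "x [^] k \<in> S" using closed x k(1) by blast
    ultimately show False using S(2) x by (simp add: skew_symmetric_def)
  qed
  \<comment> \<open>In particular \<open>S\<close> is empty if \<open>order_div3 G\<close> is, which
    settles the other branch of \<open>EE\<close>.\<close>
  have sub: "S \<subseteq> order_div3 G" using S div3 by (auto simp: order_div3_def)
  have "S = (\<Union>x\<in>S. dbl_angle G x)"
  proof
    show "S \<subseteq> (\<Union>x\<in>S. dbl_angle G x)"
    proof
      fix x assume x: "x \<in> S"
      have xG: "x \<in> carrier G" using x S by blast
      \<comment> \<open>This makes the exponent 1 respect the upper bound \<open>ord x - 1\<close>
        in \<open>dbl_angle\<close>.\<close>
      have "ord x \<ge> 3"
        using div3[OF x] ord_ge_1[OF finite_carrier xG] by (auto dest: dvd_imp_le)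
      then have "x [^] (1 :: nat) \<in> dbl_angle G x"
        unfolding dbl_angle_def by (intro CollectI exI[of _ 1]) auto
      then show "x \<in> (\<Union>x\<in>S. dbl_angle G x)" using x xG by auto
    qed
    show "(\<Union>x\<in>S. dbl_angle G x) \<subseteq> S"
      using closed by (auto simp: dbl_angle_def)
  qed
  moreover have "finite S" using S(1) finite_carrier finite_subset by blast
  ultimately show ?thesis
    using S sub unfolding EE_def by auto
qed

lemma EE_closed_pow:
  assumes "S \<in> EE G" "x \<in> S" "coprime k (order G)" "[k = 1] (mod 3)"
  shows "x [^] (k :: nat) \<in> S"
proof -
  obtain X where X: "X \<subseteq> order_div3 G" "S = (\<Union>x\<in>X. dbl_angle G x)"
    using assms(1,2) by (auto simp: EE_def split: if_splits)
  then obtain y j where y: "y \<in> X" and x: "x = y [^] j"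
    and j: "coprime j (ord y)" "[j = 1] (mod 3)"
    using assms(2) by (auto simp: dbl_angle_def)
  have yG: "y \<in> carrier G" "3 dvd ord y" using X y by (auto simp: order_div3_def)
  have o: "ord y \<ge> 3"
    using yG(2) ord_ge_1[OF finite_carrier yG(1)] by (auto dest: dvd_imp_le)
  \<comment> \<open>Reduction brings the exponent into the range of \<open>dbl_angle\<close>; as 3
    divides \<open>ord y\<close>, it keeps the residue modulo 3.\<close>
  define l where "l = (j * k) mod ord y"
  have lc: "[l = j * k] (mod ord y)" by (simp add: l_def cong_def)
  have xk: "x [^] k = y [^] l"
    using yG(1) lc by (simp add: x nat_pow_pow pow_cong_ord)
  have "coprime k (ord y)"
    using assms(3) ord_dvd_group_order[OF yG(1)] by (meson coprime_divisors dvd_refl)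
  then have "coprime (j * k) (ord y)" using j by simp
  then have cop: "coprime l (ord y)" using lc by (metis cong_imp_coprime cong_sym)
  have "[l = j * k] (mod 3)" using lc yG(2) cong_dvd_modulus_nat by blast
  moreover have "[j * k = 1 * 1] (mod 3)" using j(2) assms(4) by (rule cong_mult)
  ultimately have "[l = 1] (mod 3)" using cong_trans by fastforce
  moreover have "l \<noteq> 0" using cop o by (cases "l = 0") auto
  moreover have "l < ord y" using o by (simp add: l_def)
  ultimately have "y [^] l \<in> dbl_angle G y"
    unfolding dbl_angle_def using cop by (intro CollectI exI[of _ l]) auto
  then show ?thesis using X y xk by auto
qed

text \<open>If \<open>k\<close> is 1 modulo 3, closure of \<open>S\<close> under the exponent
  \<open>k\<close> and under its inverse modulo \<open>3 * order G\<close> shows that the weight is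
  unchanged. If \<open>k\<close> is 2 modulo 3, the first case applies to \<open>-k\<close>, and
  passing to the inverse squares the weight.\<close>

lemma EE_imp_weight_power:
  assumes E: "S \<in> EE G" and S: "skew_symmetric G S"
    and k: "k > 0" "coprime k (3 * order G)" and x: "x \<in> carrier G"
  shows "skew_weight G S (x [^] k) = skew_weight G S x ^ k"
proof -
  have one: "skew_weight G S (x [^] k) = skew_weight G S x"
    if k: "k > 0" "coprime k (3 * order G)" "[k = 1] (mod 3)" for k
  proof -
    have kn: "coprime k (order G)" using k(2) by simp
    obtain l where l: "[k * l = 1] (mod 3 * order G)"
      using cong_solve_coprime_nat[OF k(2)] by auto
    have l3: "[k * l = 1] (mod 3)" and ln: "[k * l = 1] (mod order G)"
      using l by (meson cong_dvd_modulus_nat dvd_triv_left dvd_triv_right)+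
    have "[1 * l = k * l] (mod 3)" using k(3) by (meson cong_scalar_right cong_sym)
    then have l1: "[l = 1] (mod 3)" using l3 cong_trans by fastforce
    have "coprime (k * l) (order G)"
      using ln by (metis cong_imp_coprime cong_sym coprime_1_left)
    then have lcop: "coprime l (order G)" by simp
    have "[k * l = 1] (mod ord x)"
      using ln ord_dvd_group_order[OF x] cong_dvd_modulus_nat by blast
    then have "x [^] (k * l) = x [^] (1 :: nat)" using x pow_cong_ord by blast
    then have kl: "(x [^] k) [^] l = x" using x by (simp add: nat_pow_pow)
    have "x [^] k \<in> S \<longleftrightarrow> x \<in> S"
      using EE_closed_pow[OF E _ kn k(3), of x] EE_closed_pow[OF E _ lcop l1, of "x [^] k"] kl by auto
    moreover have "inv (x [^] k) \<in> S \<longleftrightarrow> inv x \<in> S"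
      using EE_closed_pow[OF E _ kn k(3), of "inv x"]
        EE_closed_pow[OF E _ lcop l1, of "inv (x [^] k)"] kl x by (auto simp: nat_pow_inv)
    ultimately show ?thesis by (simp add: skew_weight_def)
  qed
  have "coprime k 3" using k(2) by simp
  then consider "k mod 3 = 1" | "k mod 3 = 2" using coprime_3_mod by blast
  then show ?thesis
  proof cases
    case 1
    then have k1: "[k = 1] (mod 3)" by (simp add: cong_def)
    then show ?thesis
      using one[OF k k1] skew_weight_power_cong[OF k1 k(1), of G S x] by simp
  next
    case 2
    define N where "N = 3 * order G"
    have N: "N \<ge> 3" using order_pos by (simp add: N_def)
    \<comment> \<open>A natural number representing \<open>-k\<close> modulo \<open>N\<close>; it is
      1 modulo 3 because \<open>k\<close> is 2 modulo 3.\<close>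
    define l where "l = (N - 1) * k"
    have "coprime (N - 1) N" using N by (intro coprime_diff_one_left_nat) simp
    then have "coprime l N" using k(2) by (simp add: l_def N_def)
    moreover have "l > 0" using N k(1) by (simp add: l_def)
    moreover have "[l = 1] (mod 3)"
    proof -
      have "l + k = 3 * (order G * k)"
        using N by (simp add: l_def N_def algebra_simps)
      then have "3 dvd l + k" by simp
      then show ?thesis using 2 unfolding cong_def by presburger
    qed
    ultimately have "skew_weight G S (x [^] l) = skew_weight G S x"
      using one by (simp add: N_def)
    moreover have "x [^] l = inv (x [^] k)"
    proof (rule inv_equality[symmetric])
      have "x [^] l \<otimes> x [^] k = x [^] (order G * (3 * k))"
        using x N by (simp add: nat_pow_mult l_def N_def algebra_simps)
      also have "\<dots> = \<one>"
        using x by (simp add: pow_order_eq_1 flip: nat_pow_pow)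
      finally show "x [^] l \<otimes> x [^] k = \<one>" .
    qed (use x in auto)
    ultimately have "skew_weight G S (x [^] k) = skew_weight G S x ^ 2"
      using skew_weight_inv[OF S, of "inv (x [^] k)"] x by simp
    also have "\<dots> = skew_weight G S x ^ k"
      using 2 k(1) by (intro skew_weight_power_cong) (auto simp: cong_def)
    finally show ?thesis .
  qed
qed

theorem HS_integral_Cay_iff_EE:
  assumes "S \<subseteq> carrier G" "skew_symmetric G S"
  shows "HS_integral (Cay G S) \<longleftrightarrow> S \<in> EE G"
  unfolding HS_integral_Cay_iff[OF assms(2)]
proof
  assume "\<forall>\<psi>\<in>characters. (\<Sum>x\<in>carrier G. skew_weight G S x * \<psi> x) \<in> \<int>"
  then show "S \<in> EE G"
    using integral_imp_weight_power assms by (intro weight_power_imp_EE) auto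
next
  assume "S \<in> EE G"
  then show "\<forall>\<psi>\<in>characters. (\<Sum>x\<in>carrier G. skew_weight G S x * \<psi> x) \<in> \<int>"
    using EE_imp_weight_power assms(2) weight_power_imp_integral by blast
qed

end

theorem theorem4p2:
  fixes \<Gamma> :: "('a, 'b) monoid_scheme" and S :: "'a set"
  assumes "comm_group \<Gamma>" and "finite (carrier \<Gamma>)"
    and "S \<subseteq> carrier \<Gamma>" and "skew_symmetric \<Gamma> S" and "\<one>\<^bsub>\<Gamma>\<^esub> \<notin> S"
  shows "HS_integral (Cay \<Gamma> S) \<longleftrightarrow> S \<in> EE \<Gamma>"
proof -
  interpret finite_abelian_group \<Gamma>
    using assms by (simp add: finite_abelian_group_def finite_abelian_group_axioms_def)
  show ?thesis
    using HS_integral_Cay_iff_EE assms by blast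
qed

end
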